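(* Let $\mathcal V$ be a commutative quantale. Every functor $T:\mathsf{Set}\to\mathsf{Set}$ has a $\mathcal V\text{-}\mathsf{cat}$-ification $T_{\mathcal V}:\mathcal V\text{-}\mathsf{cat}\to\mathcal V\text{-}\mathsf{cat}$, that is, the $\mathcal V\text{-}\mathsf{cat}$-enriched left Kan extension $T_{\mathcal V}=\mathrm{Lan}_D(DT)$ of $DT$ along the discrete functor $D:\mathsf{Set}\to\mathcal V\text{-}\mathsf{cat}$ exists.
   Context: $\mathcal V=(\mathcal V_o,\otimes,e,[-,-])$ is a commutative quantale: a complete lattice with a commutative, associative, monotone operation $\otimes$ with unit $e$, such that each $-\otimes r$ has a right adjoint $[r,-]$; $\mathcal V$ is assumed non-trivial ($e\neq\bot$). A (small) $\mathcal V$-category $\mathcal X$ is a set of objects together with elements $\mathcal X(x',x)\in\mathcal V_o$ satisfying $e\le\mathcal X(x,x)$ and $\mathcal X(x',x)\otimes\mathcal X(x'',x')\le\mathcal X(x'',x)$; a $\mathcal V$-functor $f:\mathcal X\to\mathcal Y$ is a map on objects with $\mathcal X(x',x)\le\mathcal Y(fx',fx)$. $\mathcal V\text{-}\mathsf{cat}$ is the symmetric monoidal closed category of small $\mathcal V$-categories and $\mathcal V$-functors, with $(\mathcal X\otimes\mathcal Y)((x',y'),(x,y))=\mathcal X(x',x)\otimes\mathcal Y(y',y)$, unit the one-object $\mathcal V$-category with self-distance $e$, and internal hom $[\mathcal Y,\mathcal Z]=\mathcal V\text{-}\mathsf{cat}(\mathcal Y,\mathcal Z)$ of $\mathcal V$-functors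 with $[\mathcal Y,\mathcal Z](f,g)=\bigwedge_y\mathcal Z(fy,gy)$; it is enriched over itself. $\mathsf{Set}$ is regarded as a $\mathcal V\text{-}\mathsf{cat}$-category whose homs are the discrete $\mathcal V$-categories (distance $e$ between equal objects, $\bot$ otherwise) on the sets of functions, so ordinary functors out of $\mathsf{Set}$ are automatically $\mathcal V\text{-}\mathsf{cat}$-functors; $D$ sends a set to the discrete $\mathcal V$-category on it. The enriched left Kan extension of $H:\mathsf{Set}\to\mathcal V\text{-}\mathsf{cat}$ along $D$ is a $\mathcal V\text{-}\mathsf{cat}$-functor $\mathrm{Lan}_DH:\mathcal V\text{-}\mathsf{cat}\to\mathcal V\text{-}\mathsf{cat}$ with $(\mathrm{Lan}_DH)\mathcal X$ naturally isomorphic to the weighted colimit $\mathcal V\text{-}\mathsf{cat}(D-,\mathcal X)*H$, where $W*F$ is defined by $\mathbb X(W*F,X)\cong[\mathbb A^{op},\mathcal V\text{-}\mathsf{cat}](W,\mathbb X(F-,X))$, naturally in $X$. *)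

theory Defs
  imports Main "HOL-Library.FuncSet"
begin

section \<open>Quantales and quantale-enriched categories\<close>

text \<open>The tensor of the quantale is \<open>(*)\<close>, its unit is \<open>1\<close>, and \<open>residual r\<close> is the right adjoint
  of \<open>\<lambda>x. x * r\<close>.\<close>

class comm_quantale = complete_lattice + comm_monoid_mult +
  fixes residual :: "'a \<Rightarrow> 'a \<Rightarrow> 'a"
  assumes tensor_mono: "x \<le> y \<Longrightarrow> x * z \<le> y * z"
    and tensor_residual: "x * r \<le> y \<longleftrightarrow> x \<le> residual r y"
    and unit_neq_bot: "1 \<noteq> bot"

record ('a, 'v) vcat =
  carr :: "'a set"
  vdist :: "'a \<Rightarrow> 'a \<Rightarrow> 'v"

text \<open>Distances are normalised to \<open>bot\<close> outside the carrier, so that equality of records is equality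
  of \<open>\<V>\<close>-categories.\<close>

definition vcategory :: "('a, 'v::comm_quantale) vcat \<Rightarrow> bool" where
  "vcategory X \<longleftrightarrow>
     (\<forall>x\<in>carr X. 1 \<le> vdist X x x) \<and>
     (\<forall>x\<in>carr X. \<forall>x'\<in>carr X. \<forall>x''\<in>carr X. vdist X x' x * vdist X x'' x' \<le> vdist X x'' x) \<and>
     (\<forall>x x'. x \<notin> carr X \<or> x' \<notin> carr X \<longrightarrow> vdist X x x' = bot)"

definition mk_vcat :: "'a set \<Rightarrow> ('a \<Rightarrow> 'a \<Rightarrow> 'v::comm_quantale) \<Rightarrow> ('a, 'v) vcat" where
  "mk_vcat A d = \<lparr>carr = A, vdist = (\<lambda>x y. if x \<in> A \<and> y \<in> A then d x y else bot)\<rparr>"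

definition vfun :: "('a, 'v::comm_quantale) vcat \<Rightarrow> ('b, 'v) vcat \<Rightarrow> ('a \<Rightarrow> 'b) set" where
  "vfun X Y = {f \<in> carr X \<rightarrow>\<^sub>E carr Y.
     \<forall>x\<in>carr X. \<forall>x'\<in>carr X. vdist X x' x \<le> vdist Y (f x') (f x)}"

definition viso :: "('a, 'v::comm_quantale) vcat \<Rightarrow> ('b, 'v) vcat \<Rightarrow> ('a \<Rightarrow> 'b) \<Rightarrow> bool" where
  "viso X Y f \<longleftrightarrow> f \<in> vfun X Y \<and>
     (\<exists>g\<in>vfun Y X. compose (carr X) g f = (\<lambda>x\<in>carr X. x) \<and>
                   compose (carr Y) f g = (\<lambda>y\<in>carr Y. y))"

definition vtensor :: "('a, 'v::comm_quantale) vcat \<Rightarrow> ('b, 'v) vcat \<Rightarrow> ('a \<times> 'b, 'v) vcat" where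
  "vtensor X Y = mk_vcat (carr X \<times> carr Y) (\<lambda>p q. vdist X (fst p) (fst q) * vdist Y (snd p) (snd q))"

definition vhom :: "('a, 'v::comm_quantale) vcat \<Rightarrow> ('b, 'v) vcat \<Rightarrow> ('a \<Rightarrow> 'b, 'v) vcat" where
  "vhom Y Z = mk_vcat (vfun Y Z) (\<lambda>f g. INF y\<in>carr Y. vdist Z (f y) (g y))"

definition discrete :: "'a set \<Rightarrow> ('a, 'v::comm_quantale) vcat" where
  "discrete A = mk_vcat A (\<lambda>x y. if x = y then 1 else bot)"


section \<open>Categories and functors enriched in \<open>\<V>-cat\<close>\<close>

record ('o, 'm, 'v) ecat =
  Ob :: "'o set"
  Hom :: "'o \<Rightarrow> 'o \<Rightarrow> ('m, 'v) vcat"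
  Comp :: "'o \<Rightarrow> 'o \<Rightarrow> 'o \<Rightarrow> 'm \<Rightarrow> 'm \<Rightarrow> 'm"
  Idt :: "'o \<Rightarrow> 'm"

text \<open>\<open>Comp \<A> a b c g f\<close> is the composite of \<open>f : a \<rightarrow> b\<close> and \<open>g : b \<rightarrow> c\<close>. A \<open>\<V>\<close>-functor from the unit
  \<open>\<V>\<close>-category is the same as an object of its codomain, so identities are given by elements.
  Commutativity of a diagram of \<open>\<V>\<close>-functors is equality of functions on objects, so the
  associativity and unit axioms are stated on elements.\<close>

definition ecategory :: "('o, 'm, 'v::comm_quantale) ecat \<Rightarrow> bool" where
  "ecategory \<A> \<longleftrightarrow>
     (\<forall>a\<in>Ob \<A>. \<forall>b\<in>Ob \<A>. vcategory (Hom \<A> a b)) \<and>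
     (\<forall>a\<in>Ob \<A>. Idt \<A> a \<in> carr (Hom \<A> a a)) \<and>
     (\<forall>a\<in>Ob \<A>. \<forall>b\<in>Ob \<A>. \<forall>c\<in>Ob \<A>.
        (\<lambda>p\<in>carr (vtensor (Hom \<A> b c) (Hom \<A> a b)). Comp \<A> a b c (fst p) (snd p))
          \<in> vfun (vtensor (Hom \<A> b c) (Hom \<A> a b)) (Hom \<A> a c)) \<and>
     (\<forall>a\<in>Ob \<A>. \<forall>b\<in>Ob \<A>. \<forall>f\<in>carr (Hom \<A> a b).
        Comp \<A> a a b f (Idt \<A> a) = f \<and> Comp \<A> a b b (Idt \<A> b) f = f) \<and>
     (\<forall>a\<in>Ob \<A>. \<forall>b\<in>Ob \<A>. \<forall>c\<in>Ob \<A>. \<forall>d\<in>Ob \<A>.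
        \<forall>f\<in>carr (Hom \<A> a b). \<forall>g\<in>carr (Hom \<A> b c). \<forall>h\<in>carr (Hom \<A> c d).
          Comp \<A> a c d h (Comp \<A> a b c g f) = Comp \<A> a b d (Comp \<A> b c d h g) f)"

definition opp :: "('o, 'm, 'v::comm_quantale) ecat \<Rightarrow> ('o, 'm, 'v) ecat" where
  "opp \<A> = \<lparr>Ob = Ob \<A>, Hom = (\<lambda>a b. Hom \<A> b a),
            Comp = (\<lambda>a b c g f. Comp \<A> c b a f g), Idt = Idt \<A>\<rparr>"

record ('o, 'm, 'p, 'n) fnctr =
  onob :: "'o \<Rightarrow> 'p"
  onhom :: "'o \<Rightarrow> 'o \<Rightarrow> 'm \<Rightarrow> 'n"

definition efunctor ::
  "('o, 'm, 'v::comm_quantale) ecat \<Rightarrow> ('p, 'n, 'v) ecat \<Rightarrow> ('o, 'm, 'p, 'n) fnctr \<Rightarrow> bool" where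
  "efunctor \<A> \<B> F \<longleftrightarrow> ecategory \<A> \<and> ecategory \<B> \<and>
     (\<forall>a\<in>Ob \<A>. onob F a \<in> Ob \<B>) \<and>
     (\<forall>a\<in>Ob \<A>. \<forall>b\<in>Ob \<A>. onhom F a b \<in> vfun (Hom \<A> a b) (Hom \<B> (onob F a) (onob F b))) \<and>
     (\<forall>a\<in>Ob \<A>. onhom F a a (Idt \<A> a) = Idt \<B> (onob F a)) \<and>
     (\<forall>a\<in>Ob \<A>. \<forall>b\<in>Ob \<A>. \<forall>c\<in>Ob \<A>. \<forall>f\<in>carr (Hom \<A> a b). \<forall>g\<in>carr (Hom \<A> b c).
        onhom F a c (Comp \<A> a b c g f) =
          Comp \<B> (onob F a) (onob F b) (onob F c) (onhom F b c g) (onhom F a b f))"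

definition fcomp ::
  "('o, 'm, 'v::comm_quantale) ecat \<Rightarrow> ('p, 'n, 'q, 'k) fnctr \<Rightarrow> ('o, 'm, 'p, 'n) fnctr
     \<Rightarrow> ('o, 'm, 'q, 'k) fnctr" where
  "fcomp \<A> G F = \<lparr>onob = (\<lambda>a. onob G (onob F a)),
     onhom = (\<lambda>a b. \<lambda>f\<in>carr (Hom \<A> a b). onhom G (onob F a) (onob F b) (onhom F a b f))\<rparr>"


section \<open>\<open>\<V>-cat\<close> and \<open>Set\<close>\<close>

text \<open>Size is handled by a collection \<open>U\<close> of subsets of a type, whose members are the small sets.
  No closure conditions on \<open>U\<close> are imposed; the usual category of sets is the case of a Grothendieck
  universe. The homs \<open>vhom X Y\<close> live on a function type and are not required to be small in the
  sense of \<open>U\<close>. For this reason \<open>VCat UNIV\<close>, on whatever type is needed, is used as codomain of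
  hom functors and weights.\<close>

definition VCat :: "'u set set \<Rightarrow> (('u, 'v::comm_quantale) vcat, 'u \<Rightarrow> 'u, 'v) ecat" where
  "VCat U = \<lparr>Ob = {X. vcategory X \<and> carr X \<in> U}, Hom = vhom,
     Comp = (\<lambda>X Y Z g f. compose (carr X) g f), Idt = (\<lambda>X. \<lambda>x\<in>carr X. x)\<rparr>"

definition SetCat :: "'u set set \<Rightarrow> ('u set, 'u \<Rightarrow> 'u, 'v::comm_quantale) ecat" where
  "SetCat U = \<lparr>Ob = U, Hom = (\<lambda>A B. discrete (A \<rightarrow>\<^sub>E B)),
     Comp = (\<lambda>A B C g f. compose A g f), Idt = (\<lambda>A. \<lambda>x\<in>A. x)\<rparr>"

definition DiscF :: "('u set, 'u \<Rightarrow> 'u, ('u, 'v::comm_quantale) vcat, 'u \<Rightarrow> 'u) fnctr" where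
  "DiscF = \<lparr>onob = discrete, onhom = (\<lambda>A B. \<lambda>f\<in>A \<rightarrow>\<^sub>E B. f)\<rparr>"

definition set_functor :: "'u set set \<Rightarrow> ('u set, 'u \<Rightarrow> 'u, 'u set, 'u \<Rightarrow> 'u) fnctr \<Rightarrow> bool" where
  "set_functor U T \<longleftrightarrow>
     (\<forall>A\<in>U. onob T A \<in> U) \<and>
     (\<forall>A\<in>U. \<forall>B\<in>U. \<forall>f\<in>A \<rightarrow>\<^sub>E B. onhom T A B f \<in> onob T A \<rightarrow>\<^sub>E onob T B) \<and>
     (\<forall>A\<in>U. onhom T A A (\<lambda>x\<in>A. x) = (\<lambda>x\<in>onob T A. x)) \<and>
     (\<forall>A\<in>U. \<forall>B\<in>U. \<forall>C\<in>U. \<forall>f\<in>A \<rightarrow>\<^sub>E B. \<forall>g\<in>B \<rightarrow>\<^sub>E C.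
        onhom T A C (compose A g f) = compose (onob T A) (onhom T B C g) (onhom T A B f))"


section \<open>Weighted colimits and left Kan extensions\<close>

text \<open>\<open>\<V>-cat\<close>-natural transformations between \<open>\<V>-cat\<close>-valued functors \<open>P\<close> and \<open>Q\<close>, whose values may
  be carried by different types. The enriched naturality condition is an equality of two
  \<open>\<V>\<close>-functors \<open>\<A>(a, b) \<rightarrow> [P a, Q b]\<close>, that is, of their values at every \<open>f\<close>.\<close>

definition etrans ::
  "('o, 'm, 'v::comm_quantale) ecat \<Rightarrow> ('o, 'm, ('w, 'v) vcat, 'w \<Rightarrow> 'w) fnctr
     \<Rightarrow> ('o, 'm, ('n, 'v) vcat, 'n \<Rightarrow> 'n) fnctr \<Rightarrow> ('o \<Rightarrow> 'w \<Rightarrow> 'n) set" where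
  "etrans \<A> P Q = {\<alpha> \<in> (\<Pi>\<^sub>E a\<in>Ob \<A>. vfun (onob P a) (onob Q a)).
     \<forall>a\<in>Ob \<A>. \<forall>b\<in>Ob \<A>. \<forall>f\<in>carr (Hom \<A> a b).
       compose (carr (onob P a)) (onhom Q a b f) (\<alpha> a) =
       compose (carr (onob P a)) (\<alpha> b) (onhom P a b f)}"

text \<open>The hom \<open>[\<A>, \<V>-cat](P, Q)\<close> of the enriched functor category, i.e. the end of
  \<open>[P a, Q a]\<close> over the objects \<open>a\<close> of \<open>\<A>\<close>.\<close>

definition fcat_hom ::
  "('o, 'm, 'v::comm_quantale) ecat \<Rightarrow> ('o, 'm, ('w, 'v) vcat, 'w \<Rightarrow> 'w) fnctr
     \<Rightarrow> ('o, 'm, ('n, 'v) vcat, 'n \<Rightarrow> 'n) fnctr \<Rightarrow> ('o \<Rightarrow> 'w \<Rightarrow> 'n, 'v) vcat" where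
  "fcat_hom \<A> P Q = mk_vcat (etrans \<A> P Q)
     (\<lambda>\<alpha> \<beta>. INF a\<in>Ob \<A>. vdist (vhom (onob P a) (onob Q a)) (\<alpha> a) (\<beta> a))"

text \<open>\<open>\<X>(C, -) : \<X> \<rightarrow> \<V>-cat\<close>\<close>

definition hom_from ::
  "('p, 'n, 'v::comm_quantale) ecat \<Rightarrow> 'p \<Rightarrow> ('p, 'n, ('n, 'v) vcat, 'n \<Rightarrow> 'n) fnctr" where
  "hom_from \<X> C = \<lparr>onob = (\<lambda>X. Hom \<X> C X),
     onhom = (\<lambda>X Y. \<lambda>g\<in>carr (Hom \<X> X Y). \<lambda>k\<in>carr (Hom \<X> C X). Comp \<X> C X Y g k)\<rparr>"

text \<open>\<open>\<X>(F -, X) : \<A>\<^sup>o\<^sup>p \<rightarrow> \<V>-cat\<close>\<close>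

definition hom_into ::
  "('o, 'm, 'v::comm_quantale) ecat \<Rightarrow> ('p, 'n, 'v) ecat \<Rightarrow> ('o, 'm, 'p, 'n) fnctr \<Rightarrow> 'p
     \<Rightarrow> ('o, 'm, ('n, 'v) vcat, 'n \<Rightarrow> 'n) fnctr" where
  "hom_into \<A> \<X> F X = \<lparr>onob = (\<lambda>a. Hom \<X> (onob F a) X),
     onhom = (\<lambda>a b. \<lambda>f\<in>carr (Hom \<A> b a). \<lambda>k\<in>carr (Hom \<X> (onob F a) X).
       Comp \<X> (onob F b) (onob F a) X k (onhom F b a f))\<rparr>"

text \<open>\<open>X \<mapsto> [\<A>\<^sup>o\<^sup>p, \<V>-cat](W, \<X>(F -, X))\<close>, acting on homs by postcomposition\<close>

definition cocones ::
  "('o, 'm, 'v::comm_quantale) ecat \<Rightarrow> ('p, 'n, 'v) ecat \<Rightarrow> ('o, 'm, ('w, 'v) vcat, 'w \<Rightarrow> 'w) fnctr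
     \<Rightarrow> ('o, 'm, 'p, 'n) fnctr
     \<Rightarrow> ('p, 'n, ('o \<Rightarrow> 'w \<Rightarrow> 'n, 'v) vcat, ('o \<Rightarrow> 'w \<Rightarrow> 'n) \<Rightarrow> ('o \<Rightarrow> 'w \<Rightarrow> 'n)) fnctr" where
  "cocones \<A> \<X> W F = \<lparr>onob = (\<lambda>X. fcat_hom (opp \<A>) W (hom_into \<A> \<X> F X)),
     onhom = (\<lambda>X Y. \<lambda>g\<in>carr (Hom \<X> X Y).
       \<lambda>\<alpha>\<in>etrans (opp \<A>) W (hom_into \<A> \<X> F X).
         \<lambda>a\<in>Ob \<A>. \<lambda>w\<in>carr (onob W a). Comp \<X> (onob F a) X Y g (\<alpha> a w))\<rparr>"

text \<open>\<open>X \<mapsto> [\<A>\<^sup>o\<^sup>p, \<V>-cat](\<C>(K -, X), G)\<close>, a functor on \<open>\<C>\<^sup>o\<^sup>p\<close> acting on homs by precomposition\<close>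

definition restricted_trans ::
  "('o, 'm, 'v::comm_quantale) ecat \<Rightarrow> ('c, 'k, 'v) ecat \<Rightarrow> ('o, 'm, 'c, 'k) fnctr
     \<Rightarrow> ('o, 'm, ('n, 'v) vcat, 'n \<Rightarrow> 'n) fnctr
     \<Rightarrow> ('c, 'k, ('o \<Rightarrow> 'k \<Rightarrow> 'n, 'v) vcat, ('o \<Rightarrow> 'k \<Rightarrow> 'n) \<Rightarrow> ('o \<Rightarrow> 'k \<Rightarrow> 'n)) fnctr" where
  "restricted_trans \<A> \<C> K G = \<lparr>onob = (\<lambda>X. fcat_hom (opp \<A>) (hom_into \<A> \<C> K X) G),
     onhom = (\<lambda>X X'. \<lambda>h\<in>carr (Hom \<C> X' X).
       \<lambda>\<alpha>\<in>etrans (opp \<A>) (hom_into \<A> \<C> K X) G.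
         \<lambda>a\<in>Ob \<A>. \<lambda>w\<in>carr (Hom \<C> (onob K a) X'). \<alpha> a (Comp \<C> (onob K a) X' X h w))\<rparr>"

text \<open>\<open>C\<close> is a colimit of \<open>F : \<A> \<rightarrow> \<X>\<close> weighted by \<open>W : \<A>\<^sup>o\<^sup>p \<rightarrow> \<V>-cat\<close>, as witnessed by the
  isomorphisms \<open>\<phi> X : \<X>(C, X) \<cong> [\<A>\<^sup>o\<^sup>p, \<V>-cat](W, \<X>(F -, X))\<close>.\<close>

definition weighted_colimit ::
  "('o, 'm, 'v::comm_quantale) ecat \<Rightarrow> ('p, 'n, 'v) ecat \<Rightarrow> ('o, 'm, ('w, 'v) vcat, 'w \<Rightarrow> 'w) fnctr
     \<Rightarrow> ('o, 'm, 'p, 'n) fnctr \<Rightarrow> 'p \<Rightarrow> ('p \<Rightarrow> 'n \<Rightarrow> 'o \<Rightarrow> 'w \<Rightarrow> 'n) \<Rightarrow> bool" where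
  "weighted_colimit \<A> \<X> W F C \<phi> \<longleftrightarrow>
     efunctor (opp \<A>) (VCat UNIV) W \<and> efunctor \<A> \<X> F \<and> C \<in> Ob \<X> \<and>
     \<phi> \<in> etrans \<X> (hom_from \<X> C) (cocones \<A> \<X> W F) \<and>
     (\<forall>X\<in>Ob \<X>. viso (Hom \<X> C X) (fcat_hom (opp \<A>) W (hom_into \<A> \<X> F X)) (\<phi> X))"

text \<open>\<open>L = Lan\<^sub>K H\<close>: each \<open>L X\<close> is the weighted colimit of \<open>H\<close> by \<open>\<C>(K -, X)\<close>, naturally in \<open>X\<close>.\<close>

definition left_Kan_extension ::
  "('o, 'm, 'v::comm_quantale) ecat \<Rightarrow> ('c, 'k, 'v) ecat \<Rightarrow> ('p, 'n, 'v) ecat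
     \<Rightarrow> ('o, 'm, 'c, 'k) fnctr \<Rightarrow> ('o, 'm, 'p, 'n) fnctr \<Rightarrow> ('c, 'k, 'p, 'n) fnctr \<Rightarrow> bool" where
  "left_Kan_extension \<A> \<C> \<B> K H L \<longleftrightarrow>
     efunctor \<A> \<C> K \<and> efunctor \<A> \<B> H \<and> efunctor \<C> \<B> L \<and>
     (\<exists>\<phi>. (\<forall>X\<in>Ob \<C>. weighted_colimit \<A> \<B> (hom_into \<A> \<C> K X) H (onob L X) (\<phi> X)) \<and>
          (\<forall>Y\<in>Ob \<B>. (\<lambda>X\<in>Ob \<C>. \<phi> X Y)
             \<in> etrans (opp \<C>) (hom_into \<C> \<B> L Y) (restricted_trans \<A> \<C> K (hom_into \<A> \<B> H Y))))"

definition Vcatification ::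
  "'u set set \<Rightarrow> ('u set, 'u \<Rightarrow> 'u, 'u set, 'u \<Rightarrow> 'u) fnctr
     \<Rightarrow> (('u, 'v::comm_quantale) vcat, 'u \<Rightarrow> 'u, ('u, 'v) vcat, 'u \<Rightarrow> 'u) fnctr \<Rightarrow> bool" where
  "Vcatification U T L \<longleftrightarrow>
     left_Kan_extension (SetCat U :: (_, _, 'v) ecat) (VCat U) (VCat U)
       DiscF (fcomp (SetCat U :: (_, _, 'v) ecat) DiscF T) L"

end

theory Submission
  imports Defs
begin

text \<open>The weight \<open>[D A, X]\<close> consists of all functions \<open>A \<rightarrow> |X|\<close>. As \<open>|X|\<close> is itself small, the Yoneda
  lemma identifies a cocone under \<open>D T\<close> with vertex \<open>Y\<close> with a single map \<open>h : T|X| \<rightarrow> |Y|\<close>, namely its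
  component at the identity of \<open>|X|\<close>; the other components are \<open>w \<mapsto> h \<circ> T w\<close>. That these are
  \<open>\<V>\<close>-functors means that \<open>\<And>\<^sub>a X (w a, w' a) \<le> Y (h (T w t), h (T w' t))\<close> for all \<open>w, w' : A \<rightarrow> |X|\<close>
  and \<open>t \<in> T A\<close>. Hence the colimit is the set \<open>T|X|\<close> with the least \<open>\<V>\<close>-category structure for which
  this inequality holds with \<open>h\<close> the identity.\<close>

section \<open>\<open>\<V>\<close>-categories and \<open>\<V>\<close>-functors\<close>

lemma tensor_mono2:
  fixes a b c d :: "'v::comm_quantale"
  assumes "a \<le> b" "c \<le> d"
  shows "a * c \<le> b * d"
proof -
  have "a * c \<le> b * c"
    by (rule tensor_mono[OF assms(1)])
  also have "\<dots> \<le> b * d"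
    using tensor_mono[OF assms(2), of b] by (simp only: mult.commute)
  finally show ?thesis .
qed

text \<open>By residuation, \<open>bot * a \<le> bot\<close> amounts to
  \<open>bot \<le> residual a bot\<close>, which always holds; commutativity gives the other
  side.\<close>

lemma tensor_bot [simp]:
  fixes a :: "'v::comm_quantale"
  shows "bot * a = bot" "a * bot = bot"
  using tensor_residual[of bot a bot] by (simp_all add: mult.commute bot_unique)

lemma vcategory_refl: "vcategory X \<Longrightarrow> x \<in> carr X \<Longrightarrow> 1 \<le> vdist X x x"
  by (simp add: vcategory_def)

text \<open>Commutativity of the tensor puts the two factors into path order, the reverse of their
  order in \<open>vcategory\<close>, so that chains of distances can be read from left to
  right.\<close>

lemma vcategory_trans:
  "vcategory X \<Longrightarrow> x \<in> carr X \<Longrightarrow> y \<in> carr X \<Longrightarrow> z \<in> carr X \<Longrightarrow>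
    vdist X x y * vdist X y z \<le> vdist X x z"
  by (subst mult.commute) (simp add: vcategory_def)

lemma carr_mk_vcat [simp]: "carr (mk_vcat A d) = A"
  by (simp add: mk_vcat_def)

lemma vdist_mk_vcat [simp]: "x \<in> A \<Longrightarrow> y \<in> A \<Longrightarrow> vdist (mk_vcat A d) x y = d x y"
  by (simp add: mk_vcat_def)

lemma vcategory_mk_vcat:
  assumes "\<And>x. x \<in> A \<Longrightarrow> 1 \<le> d x x"
    and "\<And>x y z. x \<in> A \<Longrightarrow> y \<in> A \<Longrightarrow> z \<in> A \<Longrightarrow> d x y * d y z \<le> d x z"
  shows "vcategory (mk_vcat A d)"
  unfolding vcategory_def
proof (intro conjI ballI)
  fix x y z assume "x \<in> carr (mk_vcat A d)" "y \<in> carr (mk_vcat A d)" "z \<in> carr (mk_vcat A d)"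
  then show "vdist (mk_vcat A d) y x * vdist (mk_vcat A d) z y \<le> vdist (mk_vcat A d) z x"
    by (subst mult.commute) (simp add: assms(2))
qed (auto simp: assms(1) mk_vcat_def)

lemma vfunI:
  assumes "f \<in> carr X \<rightarrow>\<^sub>E carr Y"
    and "\<And>x y. x \<in> carr X \<Longrightarrow> y \<in> carr X \<Longrightarrow> vdist X x y \<le> vdist Y (f x) (f y)"
  shows "f \<in> vfun X Y"
  using assms by (auto simp: vfun_def)

lemma vfun_PiE: "f \<in> vfun X Y \<Longrightarrow> f \<in> carr X \<rightarrow>\<^sub>E carr Y"
  by (simp add: vfun_def)

lemma vfun_carr: "f \<in> vfun X Y \<Longrightarrow> x \<in> carr X \<Longrightarrow> f x \<in> carr Y"
  by (auto simp: vfun_def)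

lemma vfun_le:
  "f \<in> vfun X Y \<Longrightarrow> x \<in> carr X \<Longrightarrow> y \<in> carr X \<Longrightarrow> vdist X x y \<le> vdist Y (f x) (f y)"
  by (simp add: vfun_def)

lemma compose_PiE: "f \<in> A \<rightarrow>\<^sub>E B \<Longrightarrow> g \<in> B \<rightarrow>\<^sub>E C \<Longrightarrow> compose A g f \<in> A \<rightarrow>\<^sub>E C"
  by (auto simp: compose_def)

lemma compose_id_right: "f \<in> A \<rightarrow>\<^sub>E B \<Longrightarrow> compose A f (\<lambda>x\<in>A. x) = f"
  by (auto simp: PiE_def intro: compose_Id)

lemma compose_id_left: "f \<in> A \<rightarrow>\<^sub>E B \<Longrightarrow> compose A (\<lambda>x\<in>B. x) f = f"
  by (auto simp: PiE_def intro: Id_compose)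

lemma compose_assoc_PiE:
  "f \<in> A \<rightarrow>\<^sub>E B \<Longrightarrow> compose A (compose B h g) f = compose A h (compose A g f)"
  by (rule compose_assoc[symmetric]) auto

lemma vfun_id: "(\<lambda>x\<in>carr X. x) \<in> vfun X X"
  by (auto simp: vfun_def)

lemma vfun_compose:
  assumes "f \<in> vfun X Y" "g \<in> vfun Y Z"
  shows "compose (carr X) g f \<in> vfun X Z"
proof (rule vfunI)
  show "compose (carr X) g f \<in> carr X \<rightarrow>\<^sub>E carr Z"
    by (rule compose_PiE[OF vfun_PiE[OF assms(1)] vfun_PiE[OF assms(2)]])
  show "vdist X x y \<le> vdist Z (compose (carr X) g f x) (compose (carr X) g f y)"
    if "x \<in> carr X" "y \<in> carr X" for x y
    using that order_trans[OF vfun_le[OF assms(1) that] vfun_le[OF assms(2)]] vfun_carr[OF assms(1)]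
    by (simp add: compose_def)
qed

lemma carr_vhom [simp]: "carr (vhom X Y) = vfun X Y"
  by (simp add: vhom_def)

lemma vdist_vhom:
  "f \<in> vfun X Y \<Longrightarrow> g \<in> vfun X Y \<Longrightarrow> vdist (vhom X Y) f g = (INF x\<in>carr X. vdist Y (f x) (g x))"
  by (simp add: vhom_def)

lemma vcategory_vhom:
  assumes "vcategory Y"
  shows "vcategory (vhom X Y)"
  unfolding vhom_def
proof (rule vcategory_mk_vcat)
  show "1 \<le> (INF x\<in>carr X. vdist Y (f x) (f x))" if "f \<in> vfun X Y" for f
    using vfun_carr[OF that] by (intro INF_greatest vcategory_refl[OF assms])
  fix f g h assume fgh: "f \<in> vfun X Y" "g \<in> vfun X Y" "h \<in> vfun X Y"
  show "(INF x\<in>carr X. vdist Y (f x) (g x)) * (INF x\<in>carr X. vdist Y (g x) (h x))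
      \<le> (INF x\<in>carr X. vdist Y (f x) (h x))"
  proof (rule INF_greatest)
    fix x assume x: "x \<in> carr X"
    have "(INF x\<in>carr X. vdist Y (f x) (g x)) * (INF x\<in>carr X. vdist Y (g x) (h x))
        \<le> vdist Y (f x) (g x) * vdist Y (g x) (h x)"
      using x by (intro tensor_mono2 INF_lower)
    also have "\<dots> \<le> vdist Y (f x) (h x)"
      using fgh[THEN vfun_carr, OF x] by (rule vcategory_trans[OF assms])
    finally show "(INF x\<in>carr X. vdist Y (f x) (g x)) * (INF x\<in>carr X. vdist Y (g x) (h x))
        \<le> vdist Y (f x) (h x)" .
  qed
qed

lemma carr_discrete [simp]: "carr (discrete A) = A"
  by (simp add: discrete_def)

lemma vcategory_discrete: "vcategory (discrete A)"
  unfolding discrete_def by (rule vcategory_mk_vcat) auto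

text \<open>Off the diagonal the source distance is \<open>bot\<close>, and on the diagonal it is
  \<open>1\<close>, where reflexivity of \<open>Y\<close> suffices. This is what turns the values of
  the weight into full function sets.\<close>

lemma vfun_discrete:
  assumes "vcategory Y"
  shows "vfun (discrete A) Y = A \<rightarrow>\<^sub>E carr Y"
proof
  show "vfun (discrete A) Y \<subseteq> A \<rightarrow>\<^sub>E carr Y"
    using vfun_PiE[of _ "discrete A" Y] by auto
  show "A \<rightarrow>\<^sub>E carr Y \<subseteq> vfun (discrete A) Y"
    using vcategory_refl[OF assms] by (auto intro!: vfunI simp: discrete_def dest: PiE_mem)
qed

lemma vdist_vhom_discrete:
  "vcategory Y \<Longrightarrow> f \<in> A \<rightarrow>\<^sub>E carr Y \<Longrightarrow> g \<in> A \<rightarrow>\<^sub>E carr Y \<Longrightarrow>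
    vdist (vhom (discrete A) Y) f g = (INF x\<in>A. vdist Y (f x) (g x))"
  by (simp add: vdist_vhom vfun_discrete)

section \<open>Enriched categories and hom functors\<close>

lemma carr_vtensor [simp]: "carr (vtensor X Y) = carr X \<times> carr Y"
  by (simp add: vtensor_def)

text \<open>Shaped after the composition clause of \<open>ecategory\<close>, so that
  \<open>ecategoryI\<close> can split that clause into closure under composition and an inequality
  of distances.\<close>

lemma vfun_vtensorI:
  assumes "\<And>x y. x \<in> carr X \<Longrightarrow> y \<in> carr Y \<Longrightarrow> c x y \<in> carr Z"
    and "\<And>x x' y y'. x \<in> carr X \<Longrightarrow> x' \<in> carr X \<Longrightarrow> y \<in> carr Y \<Longrightarrow> y' \<in> carr Y \<Longrightarrow>
      vdist X x x' * vdist Y y y' \<le> vdist Z (c x y) (c x' y')"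
  shows "(\<lambda>p\<in>carr (vtensor X Y). c (fst p) (snd p)) \<in> vfun (vtensor X Y) Z"
  using assms by (intro vfunI) (auto simp: vtensor_def)

lemma ecategory_hom: "ecategory \<A> \<Longrightarrow> a \<in> Ob \<A> \<Longrightarrow> b \<in> Ob \<A> \<Longrightarrow> vcategory (Hom \<A> a b)"
  by (simp add: ecategory_def)

lemma ecategory_id: "ecategory \<A> \<Longrightarrow> a \<in> Ob \<A> \<Longrightarrow> Idt \<A> a \<in> carr (Hom \<A> a a)"
  by (simp add: ecategory_def)

lemma ecategory_comp_vfun:
  "ecategory \<A> \<Longrightarrow> a \<in> Ob \<A> \<Longrightarrow> b \<in> Ob \<A> \<Longrightarrow> c \<in> Ob \<A> \<Longrightarrow>
    (\<lambda>p\<in>carr (vtensor (Hom \<A> b c) (Hom \<A> a b)). Comp \<A> a b c (fst p) (snd p))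
          \<in> vfun (vtensor (Hom \<A> b c) (Hom \<A> a b)) (Hom \<A> a c)"
  unfolding ecategory_def by blast

lemma ecategory_comp:
  assumes "ecategory \<A>" "a \<in> Ob \<A>" "b \<in> Ob \<A>" "c \<in> Ob \<A>"
    and "f \<in> carr (Hom \<A> a b)" "g \<in> carr (Hom \<A> b c)"
  shows "Comp \<A> a b c g f \<in> carr (Hom \<A> a c)"
  using vfun_carr[OF ecategory_comp_vfun[OF assms(1-4)], of "(g, f)"] assms(5,6) by simp

lemma ecategory_comp_le:
  assumes "ecategory \<A>" "a \<in> Ob \<A>" "b \<in> Ob \<A>" "c \<in> Ob \<A>"
    and "f \<in> carr (Hom \<A> a b)" "g \<in> carr (Hom \<A> b c)"
    and "f' \<in> carr (Hom \<A> a b)" "g' \<in> carr (Hom \<A> b c)"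
  shows "vdist (Hom \<A> b c) g g' * vdist (Hom \<A> a b) f f'
    \<le> vdist (Hom \<A> a c) (Comp \<A> a b c g f) (Comp \<A> a b c g' f')"
  using vfun_le[OF ecategory_comp_vfun[OF assms(1-4)], of "(g, f)" "(g', f')"] assms(5-8)
  by (simp add: vtensor_def)

lemma ecategory_comp_id:
  assumes "ecategory \<A>" "a \<in> Ob \<A>" "b \<in> Ob \<A>" "f \<in> carr (Hom \<A> a b)"
  shows "Comp \<A> a a b f (Idt \<A> a) = f" "Comp \<A> a b b (Idt \<A> b) f = f"
  using assms by (simp_all add: ecategory_def)

lemma ecategory_assoc:
  assumes "ecategory \<A>" "a \<in> Ob \<A>" "b \<in> Ob \<A>" "c \<in> Ob \<A>" "d \<in> Ob \<A>"
    and "f \<in> carr (Hom \<A> a b)" "g \<in> carr (Hom \<A> b c)" "h \<in> carr (Hom \<A> c d)"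
  shows "Comp \<A> a c d h (Comp \<A> a b c g f) = Comp \<A> a b d (Comp \<A> b c d h g) f"
  using assms unfolding ecategory_def by blast

lemma ecategoryI:
  assumes "\<And>a b. a \<in> Ob \<A> \<Longrightarrow> b \<in> Ob \<A> \<Longrightarrow> vcategory (Hom \<A> a b)"
    and "\<And>a. a \<in> Ob \<A> \<Longrightarrow> Idt \<A> a \<in> carr (Hom \<A> a a)"
    and "\<And>a b c f g. a \<in> Ob \<A> \<Longrightarrow> b \<in> Ob \<A> \<Longrightarrow> c \<in> Ob \<A> \<Longrightarrow>
      f \<in> carr (Hom \<A> a b) \<Longrightarrow> g \<in> carr (Hom \<A> b c) \<Longrightarrow> Comp \<A> a b c g f \<in> carr (Hom \<A> a c)"
    and "\<And>a b c f f' g g'. a \<in> Ob \<A> \<Longrightarrow> b \<in> Ob \<A> \<Longrightarrow> c \<in> Ob \<A> \<Longrightarrow>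
      f \<in> carr (Hom \<A> a b) \<Longrightarrow> f' \<in> carr (Hom \<A> a b) \<Longrightarrow>
      g \<in> carr (Hom \<A> b c) \<Longrightarrow> g' \<in> carr (Hom \<A> b c) \<Longrightarrow>
      vdist (Hom \<A> b c) g g' * vdist (Hom \<A> a b) f f'
        \<le> vdist (Hom \<A> a c) (Comp \<A> a b c g f) (Comp \<A> a b c g' f')"
    and "\<And>a b f. a \<in> Ob \<A> \<Longrightarrow> b \<in> Ob \<A> \<Longrightarrow> f \<in> carr (Hom \<A> a b) \<Longrightarrow>
      Comp \<A> a a b f (Idt \<A> a) = f"
    and "\<And>a b f. a \<in> Ob \<A> \<Longrightarrow> b \<in> Ob \<A> \<Longrightarrow> f \<in> carr (Hom \<A> a b) \<Longrightarrow>
      Comp \<A> a b b (Idt \<A> b) f = f"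
    and "\<And>a b c d f g h. a \<in> Ob \<A> \<Longrightarrow> b \<in> Ob \<A> \<Longrightarrow> c \<in> Ob \<A> \<Longrightarrow> d \<in> Ob \<A> \<Longrightarrow>
      f \<in> carr (Hom \<A> a b) \<Longrightarrow> g \<in> carr (Hom \<A> b c) \<Longrightarrow> h \<in> carr (Hom \<A> c d) \<Longrightarrow>
      Comp \<A> a c d h (Comp \<A> a b c g f) = Comp \<A> a b d (Comp \<A> b c d h g) f"
  shows "ecategory \<A>"
  unfolding ecategory_def by (intro conjI ballI vfun_vtensorI) (rule assms; assumption)+

lemma ecategory_opp:
  assumes "ecategory \<A>"
  shows "ecategory (opp \<A>)"
proof (rule ecategoryI, goal_cases)
  \<comment> \<open>Reversing composition swaps the two factors of the tensor, so the opposite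
    relies on commutativity of the quantale.\<close>
  case (4 a b c f f' g g')
  then show ?case
    using ecategory_comp_le[OF assms, of c b a g f g' f'] by (simp add: opp_def mult.commute)
qed (auto simp: opp_def ecategory_hom[OF assms] ecategory_id[OF assms] ecategory_comp[OF assms]
  ecategory_comp_id[OF assms] ecategory_assoc[OF assms])

section \<open>The enriched categories of V-categories and of sets\<close>

lemma VCat_simps [simp]:
  "Ob (VCat U) = {X. vcategory X \<and> carr X \<in> U}" "Hom (VCat U) = vhom"
  "Comp (VCat U) X Y Z g f = compose (carr X) g f" "Idt (VCat U) X = (\<lambda>x\<in>carr X. x)"
  by (simp_all add: VCat_def)

lemma SetCat_simps [simp]:
  "Ob (SetCat U) = U" "Hom (SetCat U) A B = discrete (A \<rightarrow>\<^sub>E B)"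
  "Comp (SetCat U) A B C g f = compose A g f" "Idt (SetCat U) A = (\<lambda>x\<in>A. x)"
  by (simp_all add: SetCat_def)

lemma opp_simps [simp]:
  "Ob (opp \<A>) = Ob \<A>" "Hom (opp \<A>) a b = Hom \<A> b a"
  "Comp (opp \<A>) a b c g f = Comp \<A> c b a f g" "Idt (opp \<A>) = Idt \<A>"
  by (simp_all add: opp_def)

lemma ecategory_VCat: "ecategory (VCat U :: (('u, 'v::comm_quantale) vcat, _, _) ecat)"
proof (rule ecategoryI, goal_cases)
  case (4 X Y Z f f' g g')
  then have Z: "vcategory Z" and f: "f \<in> vfun X Y" "f' \<in> vfun X Y" and g: "g \<in> vfun Y Z" "g' \<in> vfun Y Z"
    by simp_all
  \<comment> \<open>The path from \<open>g (f x)\<close> to \<open>g' (f' x)\<close> passes through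
    \<open>g' (f x)\<close>: the first leg is the distance of \<open>g\<close> and \<open>g'\<close>
    at the point \<open>f x\<close>, the second is controlled by functoriality of
    \<open>g'\<close>.\<close>
  have "vdist (vhom Y Z) g g' * vdist (vhom X Y) f f' \<le> vdist Z (g (f x)) (g' (f' x))"
    if x: "x \<in> carr X" for x
  proof -
    note fx = f[THEN vfun_carr, OF x]
    have "vdist (vhom Y Z) g g' * vdist (vhom X Y) f f'
        \<le> vdist Z (g (f x)) (g' (f x)) * vdist Y (f x) (f' x)"
      unfolding vdist_vhom[OF f] vdist_vhom[OF g]
      using x fx by (intro tensor_mono2 INF_lower)
    also have "\<dots> \<le> vdist Z (g (f x)) (g' (f x)) * vdist Z (g' (f x)) (g' (f' x))"
      using fx by (intro tensor_mono2 vfun_le[OF g(2)] order_refl)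
    also have "\<dots> \<le> vdist Z (g (f x)) (g' (f' x))"
      using fx by (intro vcategory_trans[OF Z] vfun_carr[OF g(1)] vfun_carr[OF g(2)])
    finally show ?thesis .
  qed
  then show ?case
    using f g by (auto simp: vdist_vhom vfun_compose compose_eq intro!: INF_greatest)
next
  case (7 X Y Z W f g h)
  then show ?case
    by (auto simp: compose_def fun_eq_iff dest: vfun_carr)
qed (simp_all add: vcategory_vhom vfun_id vfun_compose compose_id_right[OF vfun_PiE]
  compose_id_left[OF vfun_PiE])

lemma ecategory_SetCat: "ecategory (SetCat U :: ('u set, _, 'v::comm_quantale) ecat)"
proof (rule ecategoryI, goal_cases)
  \<comment> \<open>If \<open>f\<close> and \<open>f'\<close> or \<open>g\<close> and
    \<open>g'\<close> differ, the product is \<open>bot\<close>; otherwise both sides are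
    \<open>1\<close>.\<close>
  case (4 A B C f f' g g')
  then show ?case
    using compose_PiE[of f A B g C] by (auto simp: discrete_def mk_vcat_def)
next
  case (7 A B C D f g h)
  then show ?case
    by (auto simp: compose_def fun_eq_iff)
qed (auto simp: vcategory_discrete compose_id_right compose_id_left compose_PiE)

section \<open>Enriched functors and contravariant hom functors\<close>

lemma efunctor_ob: "efunctor \<A> \<B> F \<Longrightarrow> a \<in> Ob \<A> \<Longrightarrow> onob F a \<in> Ob \<B>"
  by (simp add: efunctor_def)

lemma efunctor_hom:
  "efunctor \<A> \<B> F \<Longrightarrow> a \<in> Ob \<A> \<Longrightarrow> b \<in> Ob \<A> \<Longrightarrow>
    onhom F a b \<in> vfun (Hom \<A> a b) (Hom \<B> (onob F a) (onob F b))"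
  by (simp add: efunctor_def)

text \<open>Composition is a V-functor in both arguments jointly; holding one of them at
  \<open>f\<close> inserts the factor \<open>vdist (Hom \<C> b a) f f\<close>, which is at least
  \<open>1\<close>.\<close>

lemma precompose_vfun:
  assumes C: "ecategory \<C>" and ob: "a \<in> Ob \<C>" "b \<in> Ob \<C>" "X \<in> Ob \<C>" and f: "f \<in> carr (Hom \<C> b a)"
  shows "(\<lambda>k\<in>carr (Hom \<C> a X). Comp \<C> b a X k f) \<in> vfun (Hom \<C> a X) (Hom \<C> b X)"
proof (rule vfunI)
  show "(\<lambda>k\<in>carr (Hom \<C> a X). Comp \<C> b a X k f) \<in> carr (Hom \<C> a X) \<rightarrow>\<^sub>E carr (Hom \<C> b X)"
    using ob f by (auto intro: ecategory_comp[OF C])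
  fix k l assume kl: "k \<in> carr (Hom \<C> a X)" "l \<in> carr (Hom \<C> a X)"
  have "vdist (Hom \<C> a X) k l * 1 \<le> vdist (Hom \<C> a X) k l * vdist (Hom \<C> b a) f f"
    using ob f by (intro tensor_mono2 order_refl vcategory_refl ecategory_hom[OF C])
  also have "\<dots> \<le> vdist (Hom \<C> b X) (Comp \<C> b a X k f) (Comp \<C> b a X l f)"
    using ob f kl by (intro ecategory_comp_le[OF C])
  finally show "vdist (Hom \<C> a X) k l \<le> vdist (Hom \<C> b X)
      ((\<lambda>k\<in>carr (Hom \<C> a X). Comp \<C> b a X k f) k) ((\<lambda>k\<in>carr (Hom \<C> a X). Comp \<C> b a X k f) l)"
    using kl by simp
qed

text \<open>Applied to \<open>DiscF\<close>, this supplies the functoriality of the weight that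
  \<open>weighted_colimit\<close> demands.\<close>

lemma efunctor_hom_into:
  assumes F: "efunctor \<A> \<X> F" and X: "X \<in> Ob \<X>"
  shows "efunctor (opp \<A>) (VCat UNIV) (hom_into \<A> \<X> F X)"
proof -
  have A: "ecategory \<A>" and C: "ecategory \<X>"
    using F by (simp_all add: efunctor_def)
  note ob = efunctor_ob[OF F]
  note hom = vfun_carr[OF efunctor_hom[OF F]]
  let ?P = "\<lambda>a b f. \<lambda>k\<in>carr (Hom \<X> (onob F a) X).
    Comp \<X> (onob F b) (onob F a) X k (onhom F b a f)"
  have P: "?P a b f \<in> vfun (Hom \<X> (onob F a) X) (Hom \<X> (onob F b) X)"
    if "a \<in> Ob \<A>" "b \<in> Ob \<A>" "f \<in> carr (Hom \<A> b a)" for a b f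
    using that X by (intro precompose_vfun[OF C] ob hom)
  have "(\<lambda>f\<in>carr (Hom \<A> b a). ?P a b f)
      \<in> vfun (Hom \<A> b a) (vhom (Hom \<X> (onob F a) X) (Hom \<X> (onob F b) X))"
    if ab: "a \<in> Ob \<A>" "b \<in> Ob \<A>" for a b
  proof (rule vfunI)
    show "(\<lambda>f\<in>carr (Hom \<A> b a). ?P a b f)
        \<in> carr (Hom \<A> b a) \<rightarrow>\<^sub>E carr (vhom (Hom \<X> (onob F a) X) (Hom \<X> (onob F b) X))"
      using P[OF ab] by auto
    fix f g assume fg: "f \<in> carr (Hom \<A> b a)" "g \<in> carr (Hom \<A> b a)"
    have "vdist (Hom \<A> b a) f g \<le> vdist (Hom \<X> (onob F b) X) (?P a b f k) (?P a b g k)"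
      if k: "k \<in> carr (Hom \<X> (onob F a) X)" for k
    proof -
      \<comment> \<open>Mirror image of \<open>precompose_vfun\<close>: now \<open>k\<close> is held
        fixed and contributes a self-distance of at least \<open>1\<close>, while \<open>f\<close>
        and \<open>g\<close> are compared through \<open>F\<close>.\<close>
      have "1 * vdist (Hom \<A> b a) f g
          \<le> vdist (Hom \<X> (onob F a) X) k k *
            vdist (Hom \<X> (onob F b) (onob F a)) (onhom F b a f) (onhom F b a g)"
        using ab fg k X
        by (intro tensor_mono2 vcategory_refl ecategory_hom[OF C] ob vfun_le[OF efunctor_hom[OF F]])
      also have "\<dots> \<le> vdist (Hom \<X> (onob F b) X) (?P a b f k) (?P a b g k)"
        using ab fg k X by (simp add: ecategory_comp_le[OF C] ob hom)
      finally show ?thesis by simp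
    qed
    then show "vdist (Hom \<A> b a) f g
      \<le> vdist (vhom (Hom \<X> (onob F a) X) (Hom \<X> (onob F b) X))
          ((\<lambda>f\<in>carr (Hom \<A> b a). ?P a b f) f) ((\<lambda>f\<in>carr (Hom \<A> b a). ?P a b f) g)"
      using fg by (simp only: restrict_apply' vdist_vhom[OF P[OF ab fg(1)] P[OF ab fg(2)]])
        (auto intro!: INF_greatest)
  qed
  moreover have "?P a a (Idt \<A> a) = (\<lambda>k\<in>carr (Hom \<X> (onob F a) X). k)" if a: "a \<in> Ob \<A>" for a
  proof -
    have "onhom F a a (Idt \<A> a) = Idt \<X> (onob F a)"
      using F a by (simp add: efunctor_def)
    then show ?thesis
      using a X by (auto simp: fun_eq_iff ecategory_comp_id[OF C] ob)
  qed
  moreover have "?P a c (Comp \<A> c b a f g) = compose (carr (Hom \<X> (onob F a) X)) (?P b c g) (?P a b f)"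
    if abc: "a \<in> Ob \<A>" "b \<in> Ob \<A>" "c \<in> Ob \<A>" and f: "f \<in> carr (Hom \<A> b a)"
      and g: "g \<in> carr (Hom \<A> c b)" for a b c f g
  proof -
    have "onhom F c a (Comp \<A> c b a f g) =
        Comp \<X> (onob F c) (onob F b) (onob F a) (onhom F b a f) (onhom F c b g)"
      using F abc f g unfolding efunctor_def by blast
    then show ?thesis
      using abc f g X
      by (auto simp: fun_eq_iff compose_def ob hom ecategory_assoc[OF C] ecategory_comp[OF C])
  qed
  ultimately show ?thesis
    unfolding efunctor_def
    using ecategory_opp[OF A] X
    by (auto simp: ecategory_VCat hom_into_def ecategory_hom[OF C] ob ecategory_id[OF A]
        ecategory_comp[OF A])
qed

section \<open>The extension of a set functor\<close>

lemma onob_DiscF [simp]: "onob DiscF = discrete"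
  and onhom_DiscF [simp]: "f \<in> A \<rightarrow>\<^sub>E B \<Longrightarrow> onhom DiscF A B f = f"
  by (simp_all add: DiscF_def)

text \<open>Cocones with vertex \<open>Y\<close>, described by their component at the identity of \<open>carr X\<close>.\<close>

definition lifts ::
  "'u set set \<Rightarrow> ('u set, 'u \<Rightarrow> 'u, 'u set, 'u \<Rightarrow> 'u) fnctr \<Rightarrow> ('u, 'v::comm_quantale) vcat
     \<Rightarrow> ('u, 'v) vcat \<Rightarrow> ('u \<Rightarrow> 'u) \<Rightarrow> bool" where
  "lifts U T X Y h \<longleftrightarrow>
     (\<forall>A\<in>U. \<forall>w\<in>A \<rightarrow>\<^sub>E carr X. \<forall>w'\<in>A \<rightarrow>\<^sub>E carr X. \<forall>t\<in>onob T A.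
        (INF a\<in>A. vdist X (w a) (w' a))
          \<le> vdist Y (h (onhom T A (carr X) w t)) (h (onhom T A (carr X) w' t)))"

text \<open>Structures on a fixed carrier are closed under pointwise infima, so the least admissible
  one is obtained as the infimum of all of them, without forming tensors of distances along
  chains.\<close>

definition lifting ::
  "'u set set \<Rightarrow> ('u set, 'u \<Rightarrow> 'u, 'u set, 'u \<Rightarrow> 'u) fnctr \<Rightarrow> ('u, 'v::comm_quantale) vcat
     \<Rightarrow> ('u, 'v) vcat" where
  "lifting U T X = mk_vcat (onob T (carr X)) (\<lambda>s s'.
     INF Y\<in>{Y. vcategory Y \<and> carr Y = onob T (carr X) \<and> lifts U T X Y (\<lambda>s. s)}. vdist Y s s')"

definition lifting_functor ::
  "'u set set \<Rightarrow> ('u set, 'u \<Rightarrow> 'u, 'u set, 'u \<Rightarrow> 'u) fnctr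
     \<Rightarrow> (('u, 'v::comm_quantale) vcat, 'u \<Rightarrow> 'u, ('u, 'v) vcat, 'u \<Rightarrow> 'u) fnctr" where
  "lifting_functor U T = \<lparr>onob = lifting U T,
     onhom = (\<lambda>X Y. \<lambda>f\<in>vfun X Y. onhom T (carr X) (carr Y) f)\<rparr>"

text \<open>The inverse Yoneda map. The two restrictions, together with the one inside
  \<open>compose\<close>, make the family extensional, as membership in \<open>etrans\<close>
  requires.\<close>

definition cocone_of ::
  "'u set set \<Rightarrow> ('u set, 'u \<Rightarrow> 'u, 'u set, 'u \<Rightarrow> 'u) fnctr \<Rightarrow> ('u, 'v::comm_quantale) vcat
     \<Rightarrow> ('u \<Rightarrow> 'u) \<Rightarrow> 'u set \<Rightarrow> ('u \<Rightarrow> 'u) \<Rightarrow> 'u \<Rightarrow> 'u" where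
  "cocone_of U T X h =
     (\<lambda>A\<in>U. \<lambda>w\<in>A \<rightarrow>\<^sub>E carr X. compose (onob T A) h (onhom T A (carr X) w))"

lemma carr_lifting [simp]: "carr (lifting U T X) = onob T (carr X)"
  by (simp add: lifting_def)

text \<open>For each admissible \<open>Y\<close> the product of the infima lies below the product of
  the distances in \<open>Y\<close>, to which the triangle inequality of \<open>Y\<close>
  applies.\<close>

lemma vcategory_lifting: "vcategory (lifting U T X)"
  unfolding lifting_def
proof (rule vcategory_mk_vcat)
  let ?S = "{Y. vcategory Y \<and> carr Y = onob T (carr X) \<and> lifts U T X Y (\<lambda>s. s)}"
  show "1 \<le> (INF Y\<in>?S. vdist Y s s)" if "s \<in> onob T (carr X)" for s
    using that by (auto intro!: INF_greatest vcategory_refl)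
  fix r s t assume rst: "r \<in> onob T (carr X)" "s \<in> onob T (carr X)" "t \<in> onob T (carr X)"
  show "(INF Y\<in>?S. vdist Y r s) * (INF Y\<in>?S. vdist Y s t) \<le> (INF Y\<in>?S. vdist Y r t)"
  proof (rule INF_greatest)
    fix Y assume Y: "Y \<in> ?S"
    have "(INF Y\<in>?S. vdist Y r s) * (INF Y\<in>?S. vdist Y s t) \<le> vdist Y r s * vdist Y s t"
      using Y by (intro tensor_mono2 INF_lower)
    also have "\<dots> \<le> vdist Y r t"
      using Y rst by (intro vcategory_trans) auto
    finally show "(INF Y\<in>?S. vdist Y r s) * (INF Y\<in>?S. vdist Y s t) \<le> vdist Y r t" .
  qed
qed

text \<open>The type annotation ties the quantale of \<open>SetCat\<close> to that of the target,
  which the type of \<open>fcomp\<close> leaves unrelated.\<close>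

abbreviation (input) DT ::
  "'u set set \<Rightarrow> ('u set, 'u \<Rightarrow> 'u, 'u set, 'u \<Rightarrow> 'u) fnctr
     \<Rightarrow> ('u set, 'u \<Rightarrow> 'u, ('u, 'v::comm_quantale) vcat, 'u \<Rightarrow> 'u) fnctr" where
  "DT U T \<equiv> fcomp (SetCat U :: ('u set, 'u \<Rightarrow> 'u, 'v) ecat) DiscF T"

context
  fixes U :: "'u set set" and T :: "('u set, 'u \<Rightarrow> 'u, 'u set, 'u \<Rightarrow> 'u) fnctr"
  assumes T: "set_functor U T"
begin

lemma set_functor_ob: "A \<in> U \<Longrightarrow> onob T A \<in> U"
  using T by (simp add: set_functor_def)

lemma set_functor_hom:
  "A \<in> U \<Longrightarrow> B \<in> U \<Longrightarrow> f \<in> A \<rightarrow>\<^sub>E B \<Longrightarrow> onhom T A B f \<in> onob T A \<rightarrow>\<^sub>E onob T B"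
  using T by (simp add: set_functor_def)

lemma set_functor_id: "A \<in> U \<Longrightarrow> onhom T A A (\<lambda>x\<in>A. x) = (\<lambda>x\<in>onob T A. x)"
  using T by (simp add: set_functor_def)

lemma set_functor_comp:
  "A \<in> U \<Longrightarrow> B \<in> U \<Longrightarrow> C \<in> U \<Longrightarrow> f \<in> A \<rightarrow>\<^sub>E B \<Longrightarrow> g \<in> B \<rightarrow>\<^sub>E C \<Longrightarrow>
    onhom T A C (compose A g f) = compose (onob T A) (onhom T B C g) (onhom T A B f)"
  using T by (simp add: set_functor_def)

lemma set_functor_mem:
  "A \<in> U \<Longrightarrow> B \<in> U \<Longrightarrow> f \<in> A \<rightarrow>\<^sub>E B \<Longrightarrow> t \<in> onob T A \<Longrightarrow> onhom T A B f t \<in> onob T B"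
  using PiE_mem[OF set_functor_hom] by blast

lemma onob_DT [simp]: "onob (DT U T) A = discrete (onob T A)"
  by (simp add: fcomp_def)

lemma onhom_DT [simp]:
  "A \<in> U \<Longrightarrow> B \<in> U \<Longrightarrow> f \<in> A \<rightarrow>\<^sub>E B \<Longrightarrow> onhom (DT U T) A B f = onhom T A B f"
  by (simp add: fcomp_def set_functor_hom)

lemma efunctor_DiscF:
  "efunctor (SetCat U) (VCat U) (DiscF :: (_, _, ('u, 'v::comm_quantale) vcat, _) fnctr)"
  unfolding efunctor_def
  by (auto simp: ecategory_SetCat ecategory_VCat vcategory_discrete vcategory_vhom DiscF_def
      vfun_discrete compose_PiE)

lemma efunctor_DT:
  "efunctor (SetCat U) (VCat U) (DT U T :: (_, _, ('u, 'v::comm_quantale) vcat, _) fnctr)"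
  unfolding efunctor_def
proof (intro conjI ballI, goal_cases)
  case (6 A B C f g)
  then show ?case
    by (simp add: compose_PiE set_functor_comp)
qed (auto simp: ecategory_SetCat ecategory_VCat vcategory_discrete vcategory_vhom
    vfun_discrete set_functor_ob
    set_functor_id fcomp_def set_functor_mem set_functor_hom)

section \<open>Universal property and functoriality of the lifting\<close>

lemma lifts_lifting:
  assumes "carr X \<in> U"
  shows "lifts U T X (lifting U T X) (\<lambda>s. s)"
  unfolding lifts_def
proof (intro ballI)
  fix A w w' t
  assume A: "A \<in> U" and w: "w \<in> A \<rightarrow>\<^sub>E carr X" "w' \<in> A \<rightarrow>\<^sub>E carr X" and t: "t \<in> onob T A"
  \<comment> \<open>The left side is a lower bound for the distance in every admissible structure,
    hence for their infimum. As \<open>carr X\<close> lies in \<open>U\<close>, both points belong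
    to the carrier, so the default \<open>bot\<close> of \<open>mk_vcat\<close> does not
    interfere.\<close>
  then show "(INF a\<in>A. vdist X (w a) (w' a))
      \<le> vdist (lifting U T X) (onhom T A (carr X) w t) (onhom T A (carr X) w' t)"
    using assms by (auto simp: lifting_def set_functor_mem lifts_def intro!: INF_greatest)
qed

text \<open>One direction composes \<open>lifts_lifting\<close> with \<open>h\<close>, the other is
  leastness. It translates between V-functors out of the colimit and the inequality that cocones
  satisfy.\<close>

lemma vfun_lifting_iff:
  assumes X: "carr X \<in> U" and Y: "vcategory Y"
  shows "h \<in> vfun (lifting U T X) Y \<longleftrightarrow> h \<in> onob T (carr X) \<rightarrow>\<^sub>E carr Y \<and> lifts U T X Y h"
proof (intro iffI conjI)
  assume h: "h \<in> vfun (lifting U T X) Y"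
  then show "h \<in> onob T (carr X) \<rightarrow>\<^sub>E carr Y"
    using vfun_PiE by fastforce
  show "lifts U T X Y h"
    unfolding lifts_def
  proof (intro ballI)
    fix A w w' t
    assume A: "A \<in> U" and w: "w \<in> A \<rightarrow>\<^sub>E carr X" "w' \<in> A \<rightarrow>\<^sub>E carr X" and t: "t \<in> onob T A"
    have "(INF a\<in>A. vdist X (w a) (w' a))
        \<le> vdist (lifting U T X) (onhom T A (carr X) w t) (onhom T A (carr X) w' t)"
      using lifts_lifting[OF X] A w t unfolding lifts_def by blast
    also have "\<dots> \<le> vdist Y (h (onhom T A (carr X) w t)) (h (onhom T A (carr X) w' t))"
      using A w t X by (intro vfun_le[OF h]) (auto intro: set_functor_mem)
    finally show "(INF a\<in>A. vdist X (w a) (w' a))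
        \<le> vdist Y (h (onhom T A (carr X) w t)) (h (onhom T A (carr X) w' t))" .
  qed
next
  assume h: "h \<in> onob T (carr X) \<rightarrow>\<^sub>E carr Y \<and> lifts U T X Y h"
  \<comment> \<open>The structure pulled back from \<open>Y\<close> along \<open>h\<close> is
    admissible exactly because \<open>h\<close> lifts, so the infimum lies below it.\<close>
  define P where "P = mk_vcat (onob T (carr X)) (\<lambda>s s'. vdist Y (h s) (h s'))"
  have "vcategory P"
    unfolding P_def using h
    by (intro vcategory_mk_vcat vcategory_refl[OF Y] vcategory_trans[OF Y]) auto
  moreover have "lifts U T X P (\<lambda>s. s)"
    using h X by (auto simp: lifts_def P_def set_functor_mem)
  ultimately have P: "P \<in> {Y. vcategory Y \<and> carr Y = onob T (carr X) \<and> lifts U T X Y (\<lambda>s. s)}"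
    by (simp add: P_def)
  have "vdist (lifting U T X) s s' \<le> vdist Y (h s) (h s')"
    if "s \<in> onob T (carr X)" "s' \<in> onob T (carr X)" for s s'
    using that INF_lower[OF P, of "\<lambda>Y. vdist Y s s'"] by (simp add: lifting_def P_def)
  then show "h \<in> vfun (lifting U T X) Y"
    using h by (intro vfunI) auto
qed

text \<open>By \<open>vfun_lifting_iff\<close> only the inequality for \<open>T f\<close> has to be
  checked. As \<open>T f\<close> after \<open>T w\<close> is \<open>T\<close> of \<open>f\<close>
  after \<open>w\<close>, it follows from \<open>lifts_lifting\<close> for \<open>Y\<close>, once
  functoriality of \<open>f\<close> has replaced distances in \<open>X\<close> by distances in
  \<open>Y\<close>.\<close>

lemma set_functor_vfun:
  assumes X: "vcategory X" "carr X \<in> U" and Y: "vcategory Y" "carr Y \<in> U" and f: "f \<in> vfun X Y"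
  shows "onhom T (carr X) (carr Y) f \<in> vfun (lifting U T X) (lifting U T Y)"
proof -
  have f': "f \<in> carr X \<rightarrow>\<^sub>E carr Y"
    using f by (rule vfun_PiE)
  have "lifts U T X (lifting U T Y) (onhom T (carr X) (carr Y) f)"
    unfolding lifts_def
  proof (intro ballI)
    fix A w w' t
    assume A: "A \<in> U" and w: "w \<in> A \<rightarrow>\<^sub>E carr X" "w' \<in> A \<rightarrow>\<^sub>E carr X" and t: "t \<in> onob T A"
    have Tf: "onhom T (carr X) (carr Y) f (onhom T A (carr X) v t)
        = onhom T A (carr Y) (compose A f v) t" if "v \<in> A \<rightarrow>\<^sub>E carr X" for v
      using A X Y that f' t by (simp add: set_functor_comp compose_eq)
    have "(INF a\<in>A. vdist X (w a) (w' a)) \<le> (INF a\<in>A. vdist Y (compose A f w a) (compose A f w' a))"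
      using w
      by (intro INF_superset_mono[OF order_refl]) (auto simp: compose_eq intro!: vfun_le[OF f])
    also have "\<dots> \<le> vdist (lifting U T Y)
        (onhom T A (carr Y) (compose A f w) t) (onhom T A (carr Y) (compose A f w') t)"
      using lifts_lifting[OF Y(2)] A compose_PiE[OF w(1) f'] compose_PiE[OF w(2) f'] t
      unfolding lifts_def by blast
    finally show "(INF a\<in>A. vdist X (w a) (w' a)) \<le> vdist (lifting U T Y)
        (onhom T (carr X) (carr Y) f (onhom T A (carr X) w t))
        (onhom T (carr X) (carr Y) f (onhom T A (carr X) w' t))"
      using Tf w by simp
  qed
  then show ?thesis
    using set_functor_hom[OF X(2) Y(2) f'] by (simp add: vfun_lifting_iff[OF X(2) vcategory_lifting])
qed

text \<open>This is \<open>lifts_lifting\<close> for \<open>Y\<close> with index set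
  \<open>carr X\<close> and the pair \<open>f\<close>, \<open>g\<close>: the inequality imposed on
  the lifting is also what makes its action on homs a V-functor.\<close>

lemma set_functor_vfun_le:
  assumes X: "vcategory X" "carr X \<in> U" and Y: "vcategory Y" "carr Y \<in> U"
    and f: "f \<in> vfun X Y" and g: "g \<in> vfun X Y"
  shows "vdist (vhom X Y) f g \<le> vdist (vhom (lifting U T X) (lifting U T Y))
    (onhom T (carr X) (carr Y) f) (onhom T (carr X) (carr Y) g)"
proof -
  note Tfg = set_functor_vfun[OF X Y f] set_functor_vfun[OF X Y g]
  show ?thesis
    unfolding vdist_vhom[OF f g] vdist_vhom[OF Tfg] carr_lifting
    using lifts_lifting[OF Y(2)] X(2) vfun_PiE[OF f] vfun_PiE[OF g]
    unfolding lifts_def by (intro INF_greatest) blast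
qed

lemma efunctor_lifting_functor:
  "efunctor (VCat U) (VCat U) (lifting_functor U T :: (('u, 'v::comm_quantale) vcat, _, _, _) fnctr)"
  unfolding efunctor_def
proof (intro conjI ballI, goal_cases)
  case (4 X Y)
  then show ?case
    by (intro vfunI) (auto simp: lifting_functor_def set_functor_vfun set_functor_vfun_le)
next
  case (6 X Y Z f g)
  then show ?case
    by (auto simp: lifting_functor_def vfun_compose set_functor_comp vfun_PiE)
qed (auto simp: ecategory_VCat lifting_functor_def vcategory_lifting set_functor_ob vfun_id
    set_functor_id)

section \<open>Cocones and the Yoneda correspondence\<close>

abbreviation (input) weight ::
  "('u, 'v::comm_quantale) vcat \<Rightarrow> ('u set, 'u \<Rightarrow> 'u, ('u \<Rightarrow> 'u, 'v) vcat, ('u \<Rightarrow> 'u) \<Rightarrow> 'u \<Rightarrow> 'u) fnctr"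
  where "weight X \<equiv> hom_into (SetCat U) (VCat U) DiscF X"

abbreviation (input) cone_target ::
  "('u, 'v::comm_quantale) vcat \<Rightarrow> ('u set, 'u \<Rightarrow> 'u, ('u \<Rightarrow> 'u, 'v) vcat, ('u \<Rightarrow> 'u) \<Rightarrow> 'u \<Rightarrow> 'u) fnctr"
  where "cone_target Y \<equiv> hom_into (SetCat U) (VCat U) (DT U T) Y"

lemma onob_weight [simp]: "onob (weight X) A = vhom (discrete A) X"
  and onob_cone_target [simp]: "onob (cone_target Y) A = vhom (discrete (onob T A)) Y"
  by (simp_all add: hom_into_def)

text \<open>Naturality is an equation between functions of \<open>w\<close>, here evaluated
  pointwise: the weight acts by precomposition with \<open>f\<close>, the target by precomposition
  with \<open>T f\<close>.\<close>

lemma cocone_iff: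
  assumes X: "vcategory X" "carr X \<in> U" and Y: "vcategory (Y :: ('u, 'v::comm_quantale) vcat)"
  shows "\<alpha> \<in> etrans (opp (SetCat U)) (weight X) (cone_target Y) \<longleftrightarrow>
    \<alpha> \<in> (\<Pi>\<^sub>E A\<in>U. vfun (vhom (discrete A) X) (vhom (discrete (onob T A)) Y)) \<and>
    (\<forall>A\<in>U. \<forall>B\<in>U. \<forall>f\<in>B \<rightarrow>\<^sub>E A. \<forall>w\<in>A \<rightarrow>\<^sub>E carr X.
       compose (onob T B) (\<alpha> A w) (onhom T B A f) = \<alpha> B (compose B w f))"
    (is "_ \<longleftrightarrow> \<alpha> \<in> ?V \<and> ?N")
proof -
  have "compose (carr (onob (weight X) A)) (onhom (cone_target Y) A B f) (\<alpha> A)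
      = compose (carr (onob (weight X) A)) (\<alpha> B) (onhom (weight X) A B f) \<longleftrightarrow>
    (\<forall>w\<in>A \<rightarrow>\<^sub>E carr X. compose (onob T B) (\<alpha> A w) (onhom T B A f) = \<alpha> B (compose B w f))"
    if "\<alpha> \<in> ?V" "A \<in> U" "B \<in> U" "f \<in> B \<rightarrow>\<^sub>E A" for A B f
  proof -
    have "\<alpha> A \<in> vfun (vhom (discrete A) X) (vhom (discrete (onob T A)) Y)"
      using that by auto
    \<comment> \<open>Knowing that \<open>\<alpha> A w\<close> lies in the hom set allows the
      restrictions in \<open>hom_into\<close> to be evaluated.\<close>
    note PiE_mem[OF vfun_PiE[OF this, unfolded carr_vhom vfun_discrete[OF X(1)] vfun_discrete[OF Y]]]
    then show ?thesis
      using that X Y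
      by (auto simp: hom_into_def vfun_discrete compose_def[of "_ \<rightarrow>\<^sub>E _"] fun_eq_iff[of "restrict _ _"])
  qed
  then show ?thesis
    unfolding etrans_def by auto
qed

lemma vdist_cocones:
  assumes "\<alpha> \<in> etrans (opp (SetCat U)) (weight X) (cone_target Y)"
    and "\<beta> \<in> etrans (opp (SetCat U)) (weight X) (cone_target Y)"
  shows "vdist (fcat_hom (opp (SetCat U)) (weight X) (cone_target Y)) \<alpha> \<beta> =
    (INF A\<in>U. vdist (vhom (vhom (discrete A) X) (vhom (discrete (onob T A)) Y)) (\<alpha> A) (\<beta> A))"
  using assms by (simp add: fcat_hom_def)

lemma carr_cocones [simp]:
  "carr (fcat_hom (opp (SetCat U)) (weight X) (cone_target Y)) =
    etrans (opp (SetCat U)) (weight X) (cone_target Y)"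
  by (simp add: fcat_hom_def)

lemma cocone_of_apply:
  "A \<in> U \<Longrightarrow> w \<in> A \<rightarrow>\<^sub>E carr X \<Longrightarrow>
    cocone_of U T X h A w = compose (onob T A) h (onhom T A (carr X) w)"
  by (simp add: cocone_of_def)

lemma cocone_of_PiE:
  assumes "carr X \<in> U" "h \<in> onob T (carr X) \<rightarrow>\<^sub>E carr Y" "A \<in> U" "w \<in> A \<rightarrow>\<^sub>E carr X"
  shows "cocone_of U T X h A w \<in> onob T A \<rightarrow>\<^sub>E carr Y"
  using assms by (simp add: cocone_of_apply compose_PiE[OF set_functor_hom])

text \<open>Functoriality of the components is the condition \<open>lifts\<close>, and naturality
  holds because \<open>h\<close> after \<open>T w\<close> after \<open>T f\<close> is
  \<open>h\<close> after \<open>T\<close> of the composite of \<open>w\<close> and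
  \<open>f\<close>.\<close>

lemma cocone_of_cocone:
  assumes X: "vcategory X" "carr X \<in> U" and Y: "vcategory (Y :: ('u, 'v::comm_quantale) vcat)"
    and h: "h \<in> vfun (lifting U T X) Y"
  shows "cocone_of U T X h \<in> etrans (opp (SetCat U)) (weight X) (cone_target Y)"
  unfolding cocone_iff[OF X Y]
proof (intro conjI PiE_I ballI)
  have h': "h \<in> onob T (carr X) \<rightarrow>\<^sub>E carr Y" and l: "lifts U T X Y h"
    using h by (simp_all add: vfun_lifting_iff[OF X(2) Y])
  show "cocone_of U T X h A = undefined" if "A \<notin> U" for A
    using that by (simp add: cocone_of_def)
  show "cocone_of U T X h A \<in> vfun (vhom (discrete A) X) (vhom (discrete (onob T A)) Y)"
    if A: "A \<in> U" for A
  proof (rule vfunI; unfold carr_vhom vfun_discrete[OF X(1)] vfun_discrete[OF Y])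
    show "cocone_of U T X h A \<in> (A \<rightarrow>\<^sub>E carr X) \<rightarrow>\<^sub>E (onob T A \<rightarrow>\<^sub>E carr Y)"
      using cocone_of_PiE[OF X(2) h' A] A by (auto simp: cocone_of_def)
    fix w w' assume w: "w \<in> A \<rightarrow>\<^sub>E carr X" "w' \<in> A \<rightarrow>\<^sub>E carr X"
    show "vdist (vhom (discrete A) X) w w' \<le> vdist (vhom (discrete (onob T A)) Y)
        (cocone_of U T X h A w) (cocone_of U T X h A w')"
      unfolding vdist_vhom_discrete[OF X(1) w]
        vdist_vhom_discrete[OF Y cocone_of_PiE[OF X(2) h' A w(1)] cocone_of_PiE[OF X(2) h' A w(2)]]
      using l A w by (auto simp: lifts_def cocone_of_apply compose_eq intro!: INF_greatest)
  qed
  fix A B f w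
  assume "A \<in> U" "B \<in> U" "f \<in> B \<rightarrow>\<^sub>E A" "w \<in> A \<rightarrow>\<^sub>E carr X"
  then show "compose (onob T B) (cocone_of U T X h A w) (onhom T B A f)
      = cocone_of U T X h B (compose B w f)"
    using X(2) by (simp add: cocone_of_apply compose_PiE set_functor_comp
      compose_assoc_PiE[OF set_functor_hom])
qed

text \<open>The Yoneda argument: the component at the identity determines the whole cocone, and
  functoriality of all the components then becomes the condition \<open>lifts\<close> on that one
  map.\<close>

lemma cocone_component_lifts:
  assumes X: "vcategory X" "carr X \<in> U" and Y: "vcategory (Y :: ('u, 'v::comm_quantale) vcat)"
    and \<alpha>: "\<alpha> \<in> etrans (opp (SetCat U)) (weight X) (cone_target Y)"
  shows "\<alpha> (carr X) (\<lambda>x\<in>carr X. x) \<in> vfun (lifting U T X) Y"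
    and "cocone_of U T X (\<alpha> (carr X) (\<lambda>x\<in>carr X. x)) = \<alpha>"
proof -
  let ?i = "\<lambda>x\<in>carr X. x"
  have i: "?i \<in> carr X \<rightarrow>\<^sub>E carr X"
    by auto
  have V: "\<alpha> \<in> (\<Pi>\<^sub>E A\<in>U. vfun (vhom (discrete A) X) (vhom (discrete (onob T A)) Y))"
    and N: "\<And>A B f w. A \<in> U \<Longrightarrow> B \<in> U \<Longrightarrow> f \<in> B \<rightarrow>\<^sub>E A \<Longrightarrow> w \<in> A \<rightarrow>\<^sub>E carr X \<Longrightarrow>
      compose (onob T B) (\<alpha> A w) (onhom T B A f) = \<alpha> B (compose B w f)"
    using \<alpha> unfolding cocone_iff[OF X Y] by blast+
  have VA: "\<alpha> A \<in> vfun (vhom (discrete A) X) (vhom (discrete (onob T A)) Y)" if "A \<in> U" for A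
    using V that by auto
  note VP = vfun_PiE[OF VA, unfolded carr_vhom vfun_discrete[OF X(1)] vfun_discrete[OF Y]]
  note PA = PiE_mem[OF VP]
  \<comment> \<open>Naturality along \<open>w\<close>, read as a morphism from \<open>A\<close> to
    the object \<open>carr X\<close> of \<open>U\<close>, evaluated at the identity.\<close>
  have yoneda: "\<alpha> A w = compose (onob T A) (\<alpha> (carr X) ?i) (onhom T A (carr X) w)"
    if "A \<in> U" "w \<in> A \<rightarrow>\<^sub>E carr X" for A w
    using N[OF X(2) that i] that by (simp add: compose_id_left)
  have "lifts U T X Y (\<alpha> (carr X) ?i)"
    unfolding lifts_def
  proof (intro ballI)
    fix A w w' t
    assume A: "A \<in> U" and w: "w \<in> A \<rightarrow>\<^sub>E carr X" "w' \<in> A \<rightarrow>\<^sub>E carr X" and t: "t \<in> onob T A"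
    have "vdist (vhom (discrete A) X) w w'
        \<le> vdist (vhom (discrete (onob T A)) Y) (\<alpha> A w) (\<alpha> A w')"
      using w by (intro vfun_le[OF VA[OF A]]) (simp_all add: vfun_discrete X)
    also have "\<dots> \<le> vdist Y (\<alpha> A w t) (\<alpha> A w' t)"
      unfolding vdist_vhom_discrete[OF Y PA[OF A w(1)] PA[OF A w(2)]] using t by (rule INF_lower)
    finally have "(INF a\<in>A. vdist X (w a) (w' a)) \<le> vdist Y (\<alpha> A w t) (\<alpha> A w' t)"
      by (simp only: vdist_vhom_discrete[OF X(1) w])
    then show "(INF a\<in>A. vdist X (w a) (w' a))
        \<le> vdist Y (\<alpha> (carr X) ?i (onhom T A (carr X) w t)) (\<alpha> (carr X) ?i (onhom T A (carr X) w' t))"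
      by (simp only: yoneda[OF A w(1)] yoneda[OF A w(2)] compose_eq[OF t])
  qed
  then show "\<alpha> (carr X) ?i \<in> vfun (lifting U T X) Y"
    using PA[OF X(2) i] by (simp add: vfun_lifting_iff[OF X(2) Y])
  show "cocone_of U T X (\<alpha> (carr X) ?i) = \<alpha>"
  proof
    fix A show "cocone_of U T X (\<alpha> (carr X) ?i) A = \<alpha> A"
    proof (cases "A \<in> U")
      case True
      \<comment> \<open>Equality of functions also concerns arguments outside the carrier of the
        weight, where both sides are \<open>undefined\<close>.\<close>
      have "\<alpha> A \<in> extensional (A \<rightarrow>\<^sub>E carr X)"
        using VP[OF True] by (simp only: PiE_iff[of "\<alpha> A"])
      moreover have "cocone_of U T X (\<alpha> (carr X) ?i) A \<in> extensional (A \<rightarrow>\<^sub>E carr X)"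
        using True by (simp add: cocone_of_def)
      moreover have "cocone_of U T X (\<alpha> (carr X) ?i) A w = \<alpha> A w" if "w \<in> A \<rightarrow>\<^sub>E carr X" for w
        by (rule trans[OF cocone_of_apply[OF True that] yoneda[OF True that, symmetric]])
      ultimately show ?thesis
        by (intro extensionalityI[of _ "A \<rightarrow>\<^sub>E carr X"])
    next
      case False
      then show ?thesis
        by (simp add: cocone_of_def PiE_arb[OF V])
    qed
  qed
qed

text \<open>\<open>T\<close> preserves the identity of \<open>carr X\<close>, so nothing is composed
  with \<open>h\<close>; together with \<open>cocone_component_lifts\<close> this makes the
  correspondence bijective.\<close>

lemma cocone_of_component:
  assumes "carr X \<in> U" "h \<in> onob T (carr X) \<rightarrow>\<^sub>E B"
  shows "cocone_of U T X h (carr X) (\<lambda>x\<in>carr X. x) = h"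
proof -
  have "(\<lambda>x\<in>carr X. x) \<in> carr X \<rightarrow>\<^sub>E carr X"
    by auto
  then show ?thesis
    using assms by (simp add: cocone_of_apply set_functor_id compose_id_right)
qed

text \<open>The distance of the cocones is an infimum over all points \<open>T w t\<close> of
  \<open>T\<close> applied to \<open>carr X\<close>. These points exhaust that set, since the
  identity is among the maps \<open>w\<close>.\<close>

lemma vdist_cocone_of:
  assumes X: "vcategory X" "carr X \<in> U" and Y: "vcategory (Y :: ('u, 'v::comm_quantale) vcat)"
    and h: "h \<in> vfun (lifting U T X) Y" and k: "k \<in> vfun (lifting U T X) Y"
  shows "vdist (fcat_hom (opp (SetCat U)) (weight X) (cone_target Y))
      (cocone_of U T X h) (cocone_of U T X k) = vdist (vhom (lifting U T X) Y) h k"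
proof -
  have h': "h \<in> onob T (carr X) \<rightarrow>\<^sub>E carr Y" and k': "k \<in> onob T (carr X) \<rightarrow>\<^sub>E carr Y"
    using h k by (simp_all add: vfun_lifting_iff[OF X(2) Y])
  note hc = cocone_of_cocone[OF X Y h] and kc = cocone_of_cocone[OF X Y k]
  let ?d = "\<lambda>A w t. vdist Y (h (onhom T A (carr X) w t)) (k (onhom T A (carr X) w t))"
  have component: "vdist (vhom (vhom (discrete A) X) (vhom (discrete (onob T A)) Y))
      (cocone_of U T X h A) (cocone_of U T X k A) = (INF w\<in>A \<rightarrow>\<^sub>E carr X. INF t\<in>onob T A. ?d A w t)"
    if A: "A \<in> U" for A
  proof -
    have "cocone_of U T X g A \<in> vfun (vhom (discrete A) X) (vhom (discrete (onob T A)) Y)"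
      if "cocone_of U T X g \<in> etrans (opp (SetCat U)) (weight X) (cone_target Y)" for g
      using that A unfolding cocone_iff[OF X Y] by blast
    note v = this[OF hc] this[OF kc]
    show ?thesis
      unfolding vdist_vhom[OF v] carr_vhom vfun_discrete[OF X(1)]
    proof (rule INF_cong[OF refl])
      fix w assume w: "w \<in> A \<rightarrow>\<^sub>E carr X"
      show "vdist (vhom (discrete (onob T A)) Y) (cocone_of U T X h A w) (cocone_of U T X k A w)
          = (INF t\<in>onob T A. ?d A w t)"
        unfolding vdist_vhom_discrete[OF Y cocone_of_PiE[OF X(2) h' A w] cocone_of_PiE[OF X(2) k' A w]]
        using A w by (intro INF_cong) (simp_all add: cocone_of_apply compose_eq)
    qed
  qed
  have "(INF A\<in>U. INF w\<in>A \<rightarrow>\<^sub>E carr X. INF t\<in>onob T A. ?d A w t)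
      = (INF s\<in>onob T (carr X). vdist Y (h s) (k s))"
  proof (rule antisym)
    have i: "(\<lambda>x\<in>carr X. x) \<in> carr X \<rightarrow>\<^sub>E carr X"
      by auto
    \<comment> \<open>Instance with index set \<open>carr X\<close> and \<open>w\<close> the
      identity, where \<open>T w t\<close> is \<open>t\<close>.\<close>
    have "(INF A\<in>U. INF w\<in>A \<rightarrow>\<^sub>E carr X. INF t\<in>onob T A. ?d A w t)
        \<le> (INF t\<in>onob T (carr X). ?d (carr X) (\<lambda>x\<in>carr X. x) t)"
      by (rule INF_lower2[OF X(2)], rule INF_lower2[OF i], rule order_refl)
    also have "\<dots> = (INF s\<in>onob T (carr X). vdist Y (h s) (k s))"
      using X by (intro INF_cong) (simp_all add: set_functor_id)
    finally show "(INF A\<in>U. INF w\<in>A \<rightarrow>\<^sub>E carr X. INF t\<in>onob T A. ?d A w t)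
        \<le> (INF s\<in>onob T (carr X). vdist Y (h s) (k s))" .
    show "(INF s\<in>onob T (carr X). vdist Y (h s) (k s))
        \<le> (INF A\<in>U. INF w\<in>A \<rightarrow>\<^sub>E carr X. INF t\<in>onob T A. ?d A w t)"
      using X(2) by (intro INF_greatest INF_lower set_functor_mem)
  qed
  then show ?thesis
    unfolding vdist_cocones[OF hc kc] vdist_vhom[OF h k] carr_lifting
    using component by (simp cong: INF_cong)
qed

lemma cocone_of_viso:
  assumes X: "vcategory X" "carr X \<in> U" and Y: "vcategory (Y :: ('u, 'v::comm_quantale) vcat)"
  shows "viso (vhom (lifting U T X) Y) (fcat_hom (opp (SetCat U)) (weight X) (cone_target Y))
    (restrict (cocone_of U T X) (vfun (lifting U T X) Y))"
  unfolding viso_def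
proof (intro conjI bexI)
  let ?E = "etrans (opp (SetCat U)) (weight X) (cone_target Y)"
  \<comment> \<open>Evaluation at the identity, the Yoneda inverse of
    \<open>cocone_of\<close>.\<close>
  let ?g = "\<lambda>\<alpha>\<in>?E. \<alpha> (carr X) (\<lambda>x\<in>carr X. x)"
  note c = cocone_of_cocone[OF X Y] and y = cocone_component_lifts[OF X Y]
  have gc: "cocone_of U T X h (carr X) (\<lambda>x\<in>carr X. x) = h" if "h \<in> vfun (lifting U T X) Y" for h
    using that vfun_PiE[OF that] by (intro cocone_of_component[OF X(2)]) simp
  show "restrict (cocone_of U T X) (vfun (lifting U T X) Y)
      \<in> vfun (vhom (lifting U T X) Y) (fcat_hom (opp (SetCat U)) (weight X) (cone_target Y))"
    by (intro vfunI) (auto simp: vdist_cocone_of[OF X Y] c)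
  show "?g \<in> vfun (fcat_hom (opp (SetCat U)) (weight X) (cone_target Y)) (vhom (lifting U T X) Y)"
  proof (intro vfunI)
    fix \<alpha> \<beta>
    assume "\<alpha> \<in> carr (fcat_hom (opp (SetCat U)) (weight X) (cone_target Y))"
      and "\<beta> \<in> carr (fcat_hom (opp (SetCat U)) (weight X) (cone_target Y))"
    then have "\<alpha> \<in> ?E" "\<beta> \<in> ?E"
      by simp_all
    \<comment> \<open>Both cocones are \<open>cocone_of\<close> of their components, so the equality
      of distances serves the inverse as well.\<close>
    then show "vdist (fcat_hom (opp (SetCat U)) (weight X) (cone_target Y)) \<alpha> \<beta>
        \<le> vdist (vhom (lifting U T X) Y) (?g \<alpha>) (?g \<beta>)"
      using vdist_cocone_of[OF X Y y(1) y(1), of \<alpha> \<beta>] y(2) by simp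
  qed (auto simp: y)
  show "compose (carr (vhom (lifting U T X) Y)) ?g (restrict (cocone_of U T X) (vfun (lifting U T X) Y))
      = (\<lambda>x\<in>carr (vhom (lifting U T X) Y). x)"
    by (auto simp: compose_def c gc)
  show "compose (carr (fcat_hom (opp (SetCat U)) (weight X) (cone_target Y)))
      (restrict (cocone_of U T X) (vfun (lifting U T X) Y)) ?g
      = (\<lambda>y\<in>carr (fcat_hom (opp (SetCat U)) (weight X) (cone_target Y)). y)"
    by (auto simp: compose_def y)
qed

section \<open>Naturality, the weighted colimit and the Kan extension\<close>

lemma cocone_of_postcompose:
  assumes "carr X \<in> U" "h \<in> onob T (carr X) \<rightarrow>\<^sub>E B"
  shows "cocone_of U T X (compose (onob T (carr X)) g h) =
    (\<lambda>A\<in>U. \<lambda>w\<in>A \<rightarrow>\<^sub>E carr X. compose (onob T A) g (cocone_of U T X h A w))"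
  using assms by (auto simp: cocone_of_def compose_def fun_eq_iff set_functor_mem)

text \<open>Functoriality of \<open>T\<close> again: \<open>h\<close> after \<open>T f\<close> after
  \<open>T w\<close> is \<open>h\<close> after \<open>T\<close> of the composite of \<open>f\<close>
  and \<open>w\<close>. It yields naturality of the colimit isomorphisms in
  \<open>X\<close>.\<close>

lemma cocone_of_precompose:
  assumes "carr X \<in> U" "carr X' \<in> U" "f \<in> carr X' \<rightarrow>\<^sub>E carr X"
  shows "cocone_of U T X' (compose (onob T (carr X')) h (onhom T (carr X') (carr X) f)) =
    (\<lambda>A\<in>U. \<lambda>w\<in>A \<rightarrow>\<^sub>E carr X'. cocone_of U T X h A (compose A f w))"
proof -
  have "compose (onob T A) (compose (onob T (carr X')) h (onhom T (carr X') (carr X) f))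
      (onhom T A (carr X') w) = cocone_of U T X h A (compose A f w)"
    if "A \<in> U" "w \<in> A \<rightarrow>\<^sub>E carr X'" for A w
    using that assms by (simp add: cocone_of_apply compose_PiE[of w A "carr X'" f] set_functor_comp
      compose_assoc_PiE[OF set_functor_hom])
  then show ?thesis
    by (auto simp: cocone_of_def[of U T X'] cong: restrict_cong)
qed

lemma weighted_colimit_lifting:
  assumes X: "vcategory X" "carr X \<in> U"
  shows "weighted_colimit (SetCat U) (VCat U) (weight X) (DT U T)
    (lifting U T X :: ('u, 'v::comm_quantale) vcat)
    (\<lambda>Y\<in>Ob (VCat U). restrict (cocone_of U T X) (vfun (lifting U T X) Y))"
  unfolding weighted_colimit_def
proof (intro conjI ballI)
  let ?\<phi> = "\<lambda>Y\<in>Ob (VCat U). restrict (cocone_of U T X) (vfun (lifting U T X) Y)"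
  show "efunctor (opp (SetCat U)) (VCat UNIV) (weight X)"
    using X by (intro efunctor_hom_into[OF efunctor_DiscF]) simp
  show "efunctor (SetCat U) (VCat U) (DT U T)"
    by (rule efunctor_DT)
  show "lifting U T X \<in> Ob (VCat U)"
    using X by (simp add: vcategory_lifting set_functor_ob)
  show iso: "viso (Hom (VCat U) (lifting U T X) Y)
      (fcat_hom (opp (SetCat U)) (weight X) (cone_target Y)) (?\<phi> Y)" if "Y \<in> Ob (VCat U)" for Y
    using that cocone_of_viso[OF X] by simp
  \<comment> \<open>Naturality in the vertex: both sides send \<open>h\<close> to the cocone whose
    value at \<open>w\<close> is \<open>g\<close> after \<open>h\<close> after \<open>T w\<close>,
    by \<open>cocone_of_postcompose\<close>.\<close>
  have "compose (vfun (lifting U T X) Y) (onhom (cocones (SetCat U) (VCat U) (weight X) (DT U T)) Y Z g)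
      (?\<phi> Y) = compose (vfun (lifting U T X) Y) (?\<phi> Z) (onhom (hom_from (VCat U) (lifting U T X)) Y Z g)"
    if Y: "Y \<in> Ob (VCat U)" and Z: "Z \<in> Ob (VCat U)" and g: "g \<in> vfun Y Z" for Y Z g
  proof (unfold compose_def, rule restrict_ext)
    fix h assume h: "h \<in> vfun (lifting U T X) Y"
    then have h': "h \<in> onob T (carr X) \<rightarrow>\<^sub>E carr Y"
      using vfun_PiE by fastforce
    have gh: "compose (onob T (carr X)) g h \<in> vfun (lifting U T X) Z"
      using vfun_compose[OF h g] by simp
    show "onhom (cocones (SetCat U) (VCat U) (weight X) (DT U T)) Y Z g (?\<phi> Y h)
        = ?\<phi> Z (onhom (hom_from (VCat U) (lifting U T X)) Y Z g h)"
      using X Y Z g h gh cocone_of_postcompose[OF X(2) h', of g]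
      by (simp add: cocones_def hom_from_def cocone_of_cocone vfun_discrete)
  qed
  then show "?\<phi> \<in> etrans (VCat U) (hom_from (VCat U) (lifting U T X))
      (cocones (SetCat U) (VCat U) (weight X) (DT U T))"
    using iso by (auto simp: etrans_def viso_def hom_from_def cocones_def)
qed

lemma Vcatification_lifting_functor:
  "Vcatification U T (lifting_functor U T :: (('u, 'v::comm_quantale) vcat, _, _, _) fnctr)"
  unfolding Vcatification_def left_Kan_extension_def
proof (intro conjI exI ballI)
  let ?L = "lifting_functor U T :: (('u, 'v::comm_quantale) vcat, _, _, _) fnctr"
  let ?\<phi> = "\<lambda>X. \<lambda>Y\<in>Ob (VCat U). restrict (cocone_of U T X) (vfun (lifting U T X) Y)"
  have L [simp]: "onob ?L = lifting U T"
    by (simp add: lifting_functor_def)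
  show "efunctor (SetCat U) (VCat U) (DiscF :: (_, _, ('u, 'v) vcat, _) fnctr)"
    by (rule efunctor_DiscF)
  show "efunctor (SetCat U) (VCat U) (DT U T :: (_, _, ('u, 'v) vcat, _) fnctr)"
    by (rule efunctor_DT)
  show "efunctor (VCat U) (VCat U) ?L"
    by (rule efunctor_lifting_functor)
  show "weighted_colimit (SetCat U) (VCat U) (weight X) (DT U T) (onob ?L X) (?\<phi> X)"
    if "X \<in> Ob (VCat U)" for X
    using that weighted_colimit_lifting[of X] by simp
  fix Y :: "('u, 'v) vcat" assume Y: "Y \<in> Ob (VCat U)"
  let ?R = "restricted_trans (SetCat U) (VCat U) DiscF (cone_target Y)"
  \<comment> \<open>Naturality in the argument of the extension, contravariantly: both sides send
    \<open>h\<close> to the cocone whose value at \<open>w\<close> is \<open>h\<close> after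
    \<open>T\<close> of the composite of \<open>f\<close> and \<open>w\<close>.\<close>
  have "compose (vfun (lifting U T X) Y) (onhom ?R X X' f) (?\<phi> X Y)
      = compose (vfun (lifting U T X) Y) (?\<phi> X' Y) (onhom (hom_into (VCat U) (VCat U) ?L Y) X X' f)"
    if X: "X \<in> Ob (VCat U)" and X': "X' \<in> Ob (VCat U)" and f: "f \<in> vfun X' X" for X X' f
  proof (unfold compose_def, rule restrict_ext)
    fix h assume h: "h \<in> vfun (lifting U T X) Y"
    have Tf: "onhom T (carr X') (carr X) f \<in> vfun (lifting U T X') (lifting U T X)"
      using X X' f by (simp add: set_functor_vfun)
    have hf: "compose (onob T (carr X')) h (onhom T (carr X') (carr X) f) \<in> vfun (lifting U T X') Y"
      using vfun_compose[OF Tf h] by simp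
    show "onhom ?R X X' f (?\<phi> X Y h) = ?\<phi> X' Y (onhom (hom_into (VCat U) (VCat U) ?L Y) X X' f h)"
      using X X' Y f h hf cocone_of_precompose[of X X' f h] vfun_PiE[OF f]
      by (simp add: restricted_trans_def hom_into_def[of "VCat U"] cocone_of_cocone vfun_discrete
          lifting_functor_def)
  qed
  moreover have "?\<phi> X Y \<in> vfun (vhom (lifting U T X) Y)
      (fcat_hom (opp (SetCat U)) (weight X) (cone_target Y))" if "X \<in> Ob (VCat U)" for X
    using that Y cocone_of_viso[of X Y] by (simp add: viso_def)
  ultimately show "(\<lambda>X\<in>Ob (VCat U). ?\<phi> X Y)
      \<in> etrans (opp (VCat U)) (hom_into (VCat U) (VCat U) ?L Y) ?R"
    by (auto simp: etrans_def[of "opp (VCat U)"] restricted_trans_def hom_into_def[of "VCat U"])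
qed

end

theorem corollary3p11:
  fixes U :: "'u set set"
    and T :: "('u set, 'u \<Rightarrow> 'u, 'u set, 'u \<Rightarrow> 'u) fnctr"
  assumes "set_functor U T"
  shows "\<exists>T_V :: (('u, 'v::comm_quantale) vcat, 'u \<Rightarrow> 'u, ('u, 'v) vcat, 'u \<Rightarrow> 'u) fnctr.
           Vcatification U T T_V"
  using Vcatification_lifting_functor[OF assms] by (rule exI)

end
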